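(* Fix an integer $d\geq 2$. Suppose that $\{(R_i,t_i)\}_{i=1}^\infty$ is a sequence of pairs consisting of finite rings $R_i$ with $|R_i|\to\infty$ and units $t_i\in R_i^\times$, and suppose that there is a constant $C$, independent of $i$, such that for every $i$ the operator $A_{t_i}$ satisfies the $C$-Salem bound over $R_i$, i.e. $$\|A_{t_i}f\|_2\leq C|R_i|^{\frac{d-1}{2}}\|f\|_2\quad\text{for all mean-zero } f:R_i^d\to\mathbb{C}.$$ Then the rings $R_i$ are eventually fields, i.e. there is $i_0$ such that $R_i$ is a field for all $i\geq i_0$.
   Context: All rings are finite, unital with $1\neq 0$, and not necessarily commutative. For a ring $R$, $R^\times$ is its group of units. For $x,y\in R^d$, $y\cdot x=y_1x_1+\dots+y_dx_d$. A function $f:R^d\to\mathbb{C}$ is mean-zero if $\sum_{x\in R^d}f(x)=0$, and $\|f\|_2=\left(\sum_{x\in R^d}|f(x)|^2\right)^{1/2}$. For $t\in R^\times$, the operator $A_t$ sends a mean-zero function $f$ on $R^d$ to the function $A_tf(x)=\sum_{y\in R^d:\,y\cdot x=t}f(y)$ on $R^d$. *)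

theory Defs
  imports Complex_Main "HOL-Library.FuncSet" "HOL-Algebra.Ring"
begin

text \<open>The module $R^d$: its elements are the functions from the index set
  $\{1, \ldots, d\}$ to the carrier of $R$, extended by \<^term>\<open>undefined\<close> outside the index set,
  so that each tuple is represented exactly once.\<close>

definition tuples :: "('a, 'b) ring_scheme \<Rightarrow> nat \<Rightarrow> (nat \<Rightarrow> 'a) set"
  where "tuples R d = {1..d} \<rightarrow>\<^sub>E carrier R"

definition dot :: "('a, 'b) ring_scheme \<Rightarrow> nat \<Rightarrow> (nat \<Rightarrow> 'a) \<Rightarrow> (nat \<Rightarrow> 'a) \<Rightarrow> 'a"
  where "dot R d y x = (\<Oplus>\<^bsub>R\<^esub>j\<in>{1..d}. y j \<otimes>\<^bsub>R\<^esub> x j)"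

text \<open>A function $f : R^d \to \mathbb{C}$ is given by a function on the whole type \<^typ>\<open>nat \<Rightarrow> 'a\<close>;
  the notions below only depend on its values on \<^term>\<open>tuples R d\<close>.\<close>

definition mean_zero :: "('a, 'b) ring_scheme \<Rightarrow> nat \<Rightarrow> ((nat \<Rightarrow> 'a) \<Rightarrow> complex) \<Rightarrow> bool"
  where "mean_zero R d f \<longleftrightarrow> (\<Sum>x\<in>tuples R d. f x) = 0"

definition norm2 :: "('a, 'b) ring_scheme \<Rightarrow> nat \<Rightarrow> ((nat \<Rightarrow> 'a) \<Rightarrow> complex) \<Rightarrow> real"
  where "norm2 R d f = sqrt (\<Sum>x\<in>tuples R d. (cmod (f x))\<^sup>2)"

definition A_op ::
    "('a, 'b) ring_scheme \<Rightarrow> nat \<Rightarrow> 'a \<Rightarrow> ((nat \<Rightarrow> 'a) \<Rightarrow> complex) \<Rightarrow> (nat \<Rightarrow> 'a) \<Rightarrow> complex"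
  where "A_op R d t f x = (\<Sum>y\<in>{y \<in> tuples R d. dot R d y x = t}. f y)"

definition salem_bound :: "('a, 'b) ring_scheme \<Rightarrow> nat \<Rightarrow> 'a \<Rightarrow> real \<Rightarrow> bool"
  where "salem_bound R d t C \<longleftrightarrow>
    (\<forall>f. mean_zero R d f \<longrightarrow>
      norm2 R d (A_op R d t f)
        \<le> C * real (card (carrier R)) powr ((real d - 1) / 2) * norm2 R d f)"

end

theory Submission
  imports Defs
    "HOL-Algebra.Group_Action"
    "HOL-Algebra.AbelCoset"
    "HOL-Computational_Algebra.Fundamental_Theorem_Algebra"
    "HOL-Computational_Algebra.Polynomial_Factorial"
    "HOL-Analysis.Convex"
begin

text \<open>
  A finite ring that satisfies the \<open>C\<close>-Salem bound and is not a division ring has at most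
  \<open>K (2 K\<^sup>2 + 1) ^ (2 K\<^sup>2)\<close> elements, where \<open>K = 2 C\<^sup>2\<close>. Since the cardinalities tend to infinity,
  the rings are eventually division rings, and finite division rings are fields.

  The Salem bound is only tested on functions \<open>1\<^sub>S - 1\<^sub>T\<close>, where \<open>S\<close> and \<open>T\<close> are sets of equally
  many vectors supported on the first two coordinates. On the points \<open>x\<close> with \<open>y \<cdot> x \<noteq> t\<close> for all
  \<open>y \<in> T\<close> the subtracted part is invisible, and the bound limits the number of coincidences
  \<open>y \<cdot> x = t = y' \<cdot> x\<close> with \<open>y, y' \<in> S\<close> (\<open>salem_pairs\<close>). Two choices of \<open>S\<close> and \<open>T\<close> give two
  restrictions on the ring \<open>R\<close>:

  \<^item> A proper right ideal \<open>M\<close> contains at most \<open>K\<close> elements \<open>m\<close> for which \<open>1 + m\<close> is a unit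
    (\<open>card_units_one_plus_right_ideal\<close>).
  \<^item> There are at most \<open>K |R|\<close> pairs \<open>(k, z)\<close> with \<open>k \<noteq> 0\<close> and \<open>k z = 0\<close> (\<open>card_zero_products\<close>).

  Let \<open>R\<close> have a nonzero nonunit. Every minimal right ideal \<open>P\<close> is then proper. By simplicity of
  \<open>P\<close>, an element \<open>m \<in> P\<close> for which \<open>1 + m\<close> is not a unit acts on \<open>P\<close> as \<open>-1\<close>, and this happens for
  at most half of \<open>P\<close>; so \<open>|P| \<le> 2 K\<close>. Hence each \<open>k\<close> that generates a minimal right ideal is
  annihilated by at least \<open>|R| / (2 K)\<close> elements, and by the second restriction the set \<open>E\<close> of
  all such \<open>k\<close> has at most \<open>2 K\<^sup>2\<close> elements. Left multiplication maps \<open>E\<close> into \<open>E \<union> {0}\<close>,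
  which leaves at most \<open>(|E| + 1) ^ |E|\<close> possibilities for the action of an element of \<open>R\<close>. The
  kernel \<open>X\<close> of this action is a proper right ideal, and \<open>1 + x\<close> is a unit for each \<open>x \<in> X\<close>: a
  nonzero right annihilator of \<open>1 + x\<close> would have a multiple \<open>k \<in> E\<close>, and then
  \<open>k = (1 + x) k = 0\<close>. So \<open>|X| \<le> K\<close> by the first restriction, and the bound for \<open>|R|\<close> follows.

  That finite division rings are commutative is Wedderburn's little theorem, proved in Witt's way
  from the class equation of the group of units. The usual factor \<open>\<Phi>\<^sub>n(q)\<close>
  of \<open>q ^ n - 1\<close> appears as the value at \<open>q\<close> of an irreducible integer factor of \<open>X ^ n - 1\<close> that
  vanishes at a primitive root of unity.
\<close>


section \<open>A cyclotomic divisor of \<open>q ^ n - 1\<close>\<close>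

lemma map_poly_of_int_mult:
  "map_poly of_int (p * q) = (map_poly of_int p * map_poly of_int q :: complex poly)"
  by (rule poly_eqI) (simp add: coeff_map_poly coeff_mult)

lemma poly_map_poly_of_int:
  "poly (map_poly of_int p) (of_int x) = (of_int (poly p x) :: complex)"
  by (induction p) (simp_all add: map_poly_pCons)

lemma norm_prod_mset:
  fixes M :: "complex multiset"
  shows "norm (prod_mset M) = prod_mset (image_mset norm M)"
  by (induction M) (simp_all add: norm_mult)

lemma prod_mset_gt:
  fixes c :: real
  assumes "M \<noteq> {#}" "c \<ge> 1" "\<And>x. x \<in># M \<Longrightarrow> c < x"
  shows "c < prod_mset M"
  using assms(1,3)
proof (induction M)
  case (add x M)
  show ?case
  proof (cases "M = {#}")
    case False
    then have "c < prod_mset M" using add by auto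
    moreover have "c < x" using add.prems by auto
    ultimately have "c * 1 < x * prod_mset M"
      using assms(2) by (intro mult_strict_mono) auto
    then show ?thesis by simp
  qed (use add.prems in auto)
qed auto

lemma norm_diff_gt_of_norm_eq_1:
  fixes z :: complex and q :: real
  assumes "norm z = 1" "z \<noteq> 1" "q \<ge> 2"
  shows "q - 1 < norm (of_real q - z)"
proof -
  have 1: "(Re z)\<^sup>2 + (Im z)\<^sup>2 = 1"
    using assms(1) by (simp add: cmod_def)
  have "Re z < 1"
  proof (rule ccontr)
    assume "\<not> Re z < 1"
    moreover have "Re z \<le> 1" using complex_Re_le_cmod[of z] assms(1) by simp
    ultimately have "Re z = 1" by simp
    with 1 have "z = 1" by (simp add: complex_eq_iff)
    with assms(2) show False by simp
  qed
  then have "q * Re z < q" using assms(3) by simp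
  have "(norm (of_real q - z))\<^sup>2 = (q - Re z)\<^sup>2 + (Im z)\<^sup>2"
    by (simp add: cmod_power2)
  with 1 \<open>q * Re z < q\<close> have "(q - 1)\<^sup>2 < (norm (of_real q - z))\<^sup>2"
    by (simp add: power2_eq_square algebra_simps)
  then show ?thesis by (rule power2_less_imp_less) simp
qed

text \<open>
  If \<open>q\<close> is the size of the centre of a division ring with \<open>q ^ n\<close> elements, such an \<open>N\<close> divides the
  size of every noncentral conjugacy class but not the number of nonzero central elements. It is
  \<open>Q(q)\<close>, where \<open>Q\<close> is an irreducible integer factor of \<open>X ^ n - 1\<close> with the root
  \<open>\<zeta> = e ^ (2 \<pi> i / n)\<close>. Because \<open>\<zeta>\<close> has order \<open>n\<close>, the prime \<open>Q\<close> does not divide \<open>X ^ k - 1\<close>, so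
  it divides the cofactor of \<open>X ^ k - 1\<close> in \<open>X ^ n - 1\<close>; this gives the divisibilities. All complex
  roots of \<open>Q\<close> lie on the unit circle and differ from \<open>1\<close>, hence have distance more than \<open>q - 1\<close>
  from \<open>q\<close>; since \<open>Q\<close> has leading coefficient \<open>\<plusminus>1\<close>, it follows that \<open>|Q(q)| > q - 1\<close>.
\<close>

lemma cyclotomic_divisor:
  fixes q n :: nat
  assumes q: "q \<ge> 2" and n: "n \<ge> 2"
  obtains N :: int where
    "\<And>k. k dvd n \<Longrightarrow> k < n \<Longrightarrow> N * (int q ^ k - 1) dvd int q ^ n - 1"
    "\<not> N dvd int q - 1"
proof -
  define h where "h = (map_poly of_int :: int poly \<Rightarrow> complex poly)"
  have h_mult: "h (a * b) = h a * h b" for a b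
    unfolding h_def by (rule map_poly_of_int_mult)
  define X where "X k = (monom 1 k - 1 :: int poly)" for k
  have "h (X k) = monom 1 k - 1" for k
    by (rule poly_eqI) (simp add: h_def X_def coeff_map_poly)
  then have hX: "poly (h (X k)) z = z ^ k - 1" for k z
    by (simp add: poly_monom)
  have qX: "poly (X k) x = x ^ k - 1" for k x
    by (simp add: X_def poly_monom)
  have X_nz: "X n \<noteq> 0"
  proof
    assume "X n = 0"
    then have "(2::int) ^ n - 1 = 0" using qX[of n 2] by simp
    moreover have "(2::int) ^ n \<ge> 2 ^ 1" using n by (intro power_increasing) auto
    ultimately show False by simp
  qed
  define \<zeta> where "\<zeta> = cis (2 * pi / n)"
  have zeta_pow: "\<zeta> ^ k = cis (2 * pi * k / n)" for k
    by (simp add: \<zeta>_def DeMoivre mult_ac)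
  have zeta_n: "\<zeta> ^ n = 1" using n by (simp add: zeta_pow)
  have zeta_k: "\<zeta> ^ k \<noteq> 1" if "0 < k" "k < n" for k
  proof
    assume "\<zeta> ^ k = 1"
    then have "cis (2 * pi * real k / real n) = cis (2 * pi * real 0 / real n)"
      by (simp add: zeta_pow)
    then have "k = 0"
      using inj_onD[OF bij_betw_imp_inj_on[OF bij_betw_roots_unity[of n]], of k 0] that by simp
    with that show False by simp
  qed
  obtain Q where Q: "prime Q" "Q dvd X n" "poly (h Q) \<zeta> = 0"
  proof -
    obtain A where A: "\<And>x. x \<in># A \<Longrightarrow> prime x" "normalize (prod_mset A) = normalize (X n)"
      using prime_factorization_exists'[OF X_nz] by blast
    have "X n dvd prod_mset A" using A(2) by (metis associated_iff_dvd)
    then obtain r where "prod_mset A = X n * r" by (elim dvdE)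
    then have "poly (h (prod_mset A)) \<zeta> = 0"
      by (simp add: h_mult hX zeta_n)
    moreover have "poly (h (prod_mset B)) \<zeta> = 0 \<Longrightarrow> \<exists>Q\<in>#B. poly (h Q) \<zeta> = 0" for B
      by (induction B) (auto simp: h_mult, simp add: h_def)
    ultimately obtain Q where "Q \<in># A" "poly (h Q) \<zeta> = 0" by blast
    moreover have "Q dvd X n"
      using dvd_prod_mset[OF \<open>Q \<in># A\<close>] A(2) by (metis associated_iff_dvd dvd_trans)
    ultimately show ?thesis using that A(1) by blast
  qed
  then obtain S where S: "X n = Q * S" by (elim dvdE)
  have Q_dvd: "\<exists>T. X n = Q * T * X k" if k: "k dvd n" "k < n" for k
  proof -
    have "0 < k" using k n by (cases k) auto
    obtain m where m: "n = k * m" using k by (elim dvdE)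
    have "X n = X k * (\<Sum>i<m. monom 1 k ^ i)"
      using power_diff_1_eq[of "monom 1 k :: int poly" m]
      by (simp add: X_def m monom_power)
    then have "Q dvd X k \<or> Q dvd (\<Sum>i<m. monom 1 k ^ i)"
      using Q by (metis prime_dvd_mult_iff)
    moreover have "\<not> Q dvd X k"
    proof
      assume "Q dvd X k"
      then have "poly (h (X k)) \<zeta> = 0" using Q(3) by (auto simp: h_mult)
      then show False using zeta_k[OF \<open>0 < k\<close> \<open>k < n\<close>] by (simp add: hX)
    qed
    ultimately obtain T where "(\<Sum>i<m. monom 1 k ^ i) = Q * T" by auto
    with \<open>X n = X k * _\<close> have "X n = Q * T * X k" by (simp add: mult_ac)
    then show ?thesis ..
  qed
  show ?thesis
  proof
    fix k assume "k dvd n" "k < n"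
    then obtain T where T: "X n = Q * T * X k" using Q_dvd by blast
    have "int q ^ n - 1 = poly (X n) (int q)" by (simp add: qX)
    also have "\<dots> = poly Q (int q) * (int q ^ k - 1) * poly T (int q)" unfolding T by (simp add: qX)
    finally show "poly Q (int q) * (int q ^ k - 1) dvd int q ^ n - 1" by simp
  next
    have root: "norm z = 1 \<and> z \<noteq> 1" if z: "poly (h Q) z = 0" for z
    proof
      have "z ^ n - 1 = poly (h Q) z * poly (h S) z"
        by (simp flip: hX poly_mult h_mult add: S)
      then have "z ^ n = 1" using z by simp
      then have "norm z ^ n = 1" by (metis norm_one norm_power)
      then show "norm z = 1" using n power_eq_imp_eq_base[of "norm z" n 1] by simp
      \<comment> \<open>The cofactor \<open>1 + X + \<dots> + X ^ (n - 1)\<close> of \<open>X - 1\<close> is a multiple of \<open>Q\<close>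
        and takes the value \<open>n\<close> at 1.\<close>
      obtain T where T: "X n = Q * T * X 1" using Q_dvd[of 1] n by auto
      have X1: "X 1 \<noteq> 0" using T X_nz by auto
      have "X n = X 1 * (\<Sum>i<n. monom 1 1 ^ i)"
        using power_diff_1_eq[of "monom 1 1 :: int poly" n]
        by (simp add: X_def monom_power)
      with T X1 have *: "(\<Sum>i<n. monom 1 1 ^ i) = Q * T"
        by (metis mult.commute mult_left_cancel)
      have "poly (Q * T) 1 = int n" by (simp flip: * add: poly_sum poly_monom)
      then have "poly (h (Q * T)) (of_int 1) = of_nat n"
        unfolding h_def poly_map_poly_of_int by simp
      then show "z \<noteq> 1" using z n by (auto simp: h_mult)
    qed
    have "lead_coeff Q * lead_coeff S = lead_coeff (X n)" by (simp add: S lead_coeff_mult)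
    also have "lead_coeff (X n) = 1"
    proof -
      have "X n = - 1 + monom 1 n" by (simp add: X_def)
      also have "lead_coeff \<dots> = lead_coeff (monom 1 n :: int poly)"
        using n by (subst lead_coeff_add_le) (auto simp: degree_monom_eq)
      finally show ?thesis by (simp add: degree_monom_eq)
    qed
    finally have "\<bar>lead_coeff Q\<bar> = 1" by (metis dvd_triv_left zdvd1_eq)
    have deg: "degree (h Q) = degree Q" unfolding h_def by (simp add: degree_map_poly)
    have lc: "norm (lead_coeff (h Q)) = 1"
      unfolding deg using \<open>\<bar>lead_coeff Q\<bar> = 1\<close> by (simp add: h_def coeff_map_poly flip: of_int_abs)
    have hQ: "h Q \<noteq> 0" using lc by auto
    have ne: "proots (h Q) \<noteq> {#}"
    proof -
      have "\<zeta> \<in># proots (h Q)" using Q(3) hQ by simp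
      then show ?thesis by auto
    qed
    have "real q - 1 < prod_mset (image_mset (\<lambda>z. norm (of_real (real q) - z)) (proots (h Q)))"
      using ne root q hQ
      by (intro prod_mset_gt) (auto intro!: norm_diff_gt_of_norm_eq_1 simp del: of_real_of_nat_eq)
    also have "\<dots> = norm (poly (h Q) (of_real (real q)))"
      by (subst complex_poly_decompose_multiset[symmetric])
        (simp add: poly_prod_mset norm_mult lc norm_prod_mset image_mset.compositionality o_def)
    also have "poly (h Q) (of_real (real q)) = of_int (poly Q (int q))"
      using poly_map_poly_of_int[of Q "int q"] by (simp add: h_def)
    also have "norm (of_int (poly Q (int q)) :: complex) = real_of_int \<bar>poly Q (int q)\<bar>" by simp
    finally have "int q - 1 < \<bar>poly Q (int q)\<bar>" by linarith
    then show "\<not> poly Q (int q) dvd int q - 1"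
      using q zdvd_imp_le[of "\<bar>poly Q (int q)\<bar>" "int q - 1"] by auto
  qed
qed


section \<open>Finite division rings are fields\<close>

locale finite_ring = ring +
  assumes finite_carrier: "finite (carrier R)"
    and one_not_zero: "\<one> \<noteq> \<zero>"

context ring
begin

lemma additive_subgroupI_minus:
  assumes "H \<subseteq> carrier R" "\<zero> \<in> H" "\<And>x y. x \<in> H \<Longrightarrow> y \<in> H \<Longrightarrow> x \<ominus> y \<in> H"
  shows "additive_subgroup H R"
proof (rule additive_subgroupI, rule add.subgroupI)
  show "H \<subseteq> carrier R" by fact
  show "H \<noteq> {}" using assms by blast
  have neg: "\<ominus> a \<in> H" if "a \<in> H" for a
    using assms(3)[OF assms(2) that] that assms(1) by (auto simp: minus_eq)
  then show "\<And>a. a \<in> H \<Longrightarrow> \<ominus> a \<in> H" .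
  show "a \<oplus> b \<in> H" if "a \<in> H" "b \<in> H" for a b
    using assms(3)[OF that(1) neg[OF that(2)]] that assms(1) by (auto simp: minus_eq)
qed

lemma minus_eq_zeroD:
  assumes "x \<ominus> y = \<zero>" "x \<in> carrier R" "y \<in> carrier R"
  shows "x = y"
proof -
  have "x \<ominus> y \<oplus> y = x" using assms(2,3) by (simp add: minus_eq a_assoc l_neg)
  then show ?thesis using assms by simp
qed

lemma additive_subgroup_minus_closed:
  assumes "additive_subgroup H R" "x \<in> H" "y \<in> H"
  shows "x \<ominus> y \<in> H"
  using assms by (simp add: minus_eq additive_subgroup.a_closed additive_subgroup.a_inv_closed)

end

locale finite_division_ring = finite_ring +
  assumes Units_eq: "Units R = carrier R - {\<zero>}"
begin

definition division_subring :: "'a set \<Rightarrow> bool" where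
  "division_subring F \<longleftrightarrow> additive_subgroup F R \<and> \<one> \<in> F \<and> (\<forall>x\<in>F. \<forall>y\<in>F. x \<otimes> y \<in> F)
     \<and> (\<forall>x\<in>F. x \<noteq> \<zero> \<longrightarrow> inv x \<in> F)"

definition centralizer :: "'a \<Rightarrow> 'a set" where
  "centralizer a = {x \<in> carrier R. x \<otimes> a = a \<otimes> x}"

definition centre :: "'a set" where
  "centre = {x \<in> carrier R. \<forall>a\<in>carrier R. x \<otimes> a = a \<otimes> x}"

lemma inv_commute:
  assumes "x \<in> Units R" "a \<in> carrier R" "x \<otimes> a = a \<otimes> x"
  shows "inv x \<otimes> a = a \<otimes> inv x"
proof -
  have "inv x \<otimes> a = inv x \<otimes> (a \<otimes> x) \<otimes> inv x"
    using assms(1,2) by (simp add: m_assoc Units_closed)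
  also have "\<dots> = inv x \<otimes> (x \<otimes> a) \<otimes> inv x" by (simp add: assms)
  also have "\<dots> = a \<otimes> inv x" using assms(1,2) by (simp flip: m_assoc add: Units_closed)
  finally show ?thesis .
qed

lemma division_subring_centralizer:
  assumes "a \<in> carrier R"
  shows "division_subring (centralizer a)"
proof -
  have "additive_subgroup (centralizer a) R"
    using assms by (intro additive_subgroupI_minus)
      (auto simp: centralizer_def minus_eq l_distr r_distr l_minus r_minus)
  moreover have "x \<otimes> y \<in> centralizer a" if "x \<in> centralizer a" "y \<in> centralizer a" for x y
    using that assms by (auto simp: centralizer_def) (metis m_assoc)
  moreover have "inv x \<in> centralizer a" if "x \<in> centralizer a" "x \<noteq> \<zero>" for x
    using that assms Units_eq by (auto simp: centralizer_def intro!: inv_commute)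
  ultimately show ?thesis
    using assms by (auto simp: division_subring_def) (simp add: centralizer_def)
qed

lemma centre_eq_Inter: "centre = (\<Inter>a\<in>carrier R. centralizer a)"
  using zero_closed by (auto simp: centre_def centralizer_def)

lemma division_subring_centre: "division_subring centre"
proof -
  have C: "division_subring (centralizer a)" if "a \<in> carrier R" for a
    using division_subring_centralizer that .
  have "additive_subgroup centre R"
  proof (rule additive_subgroupI_minus)
    show "centre \<subseteq> carrier R" by (auto simp: centre_def)
    show "\<zero> \<in> centre" by (simp add: centre_def)
    show "x \<ominus> y \<in> centre" if "x \<in> centre" "y \<in> centre" for x y
      using that by (simp add: centre_def minus_eq l_distr r_distr l_minus r_minus)
  qed
  then show ?thesis
    using C unfolding division_subring_def centre_eq_Inter by blast
qed

lemma card_division_subring_ge_2: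
  assumes "division_subring F"
  shows "card F \<ge> 2"
proof -
  interpret F: additive_subgroup F R using assms by (simp add: division_subring_def)
  have "{\<zero>, \<one>} \<subseteq> F" using assms F.zero_closed by (auto simp: division_subring_def)
  moreover have "finite F" using F.a_subset finite_carrier by (rule finite_subset)
  ultimately have "card {\<zero>, \<one>} \<le> card F" by (intro card_mono)
  then show ?thesis using one_not_zero by simp
qed

text \<open>
  Over a division ring \<open>F\<close> the left vector space \<open>V\<close> has a basis. Instead of bases the proof takes
  a maximal subspace \<open>W\<close> whose cardinality is a power of \<open>|F|\<close>: for \<open>v \<in> V - W\<close> the sum
  \<open>W + F v\<close> is direct, so it is a larger subspace of cardinality \<open>|W| |F|\<close>.
\<close>

lemma card_eq_power_card_division_subring:
  assumes F: "division_subring F" and V: "additive_subgroup V R"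
    and FV: "\<And>f v. f \<in> F \<Longrightarrow> v \<in> V \<Longrightarrow> f \<otimes> v \<in> V"
  shows "\<exists>m. card V = card F ^ m"
proof -
  interpret F: additive_subgroup F R using F by (simp add: division_subring_def)
  interpret V: additive_subgroup V R by fact
  define \<S> where "\<S> = {W. additive_subgroup W R \<and> W \<subseteq> V
     \<and> (\<forall>f\<in>F. \<forall>w\<in>W. f \<otimes> w \<in> W) \<and> (\<exists>m. card W = card F ^ m)}"
  have "finite V" using V.a_subset finite_carrier by (rule finite_subset)
  then have "finite \<S>" by (intro finite_subset[of \<S> "Pow V"]) (auto simp: \<S>_def)
  moreover have "{\<zero>} \<in> \<S>"
  proof -
    have "additive_subgroup {\<zero>} R" by (intro additive_subgroupI_minus) (auto simp: minus_eq)
    moreover have "card {\<zero>} = card F ^ 0" by simp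
    ultimately show ?thesis 
      using F.a_subset V.zero_closed unfolding \<S>_def by (auto intro: exI[of _ 0])
  qed
  ultimately obtain W where W: "W \<in> \<S>" "\<And>W'. W' \<in> \<S> \<Longrightarrow> W \<subseteq> W' \<Longrightarrow> W = W'"
    using finite_has_maximal[of \<S>] by blast
  interpret W: additive_subgroup W R using W(1) by (simp add: \<S>_def)
  have FW: "f \<otimes> w \<in> W" if "f \<in> F" "w \<in> W" for f w using W(1) that by (auto simp: \<S>_def)
  obtain m where m: "card W = card F ^ m" using W(1) by (auto simp: \<S>_def)
  have "W = V"
  proof (rule ccontr)
    assume "W \<noteq> V"
    then obtain v where v: "v \<in> V" "v \<notin> W" using W(1) by (auto simp: \<S>_def)
    have vR: "v \<in> carrier R" using v(1) V.a_subset by blast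
    have FR: "f \<in> carrier R" if "f \<in> F" for f using that F.a_subset by blast
    have WR: "w \<in> carrier R" if "w \<in> W" for w using that W.a_subset by blast
    define g where "g = (\<lambda>(w, f). w \<oplus> f \<otimes> v)"
    have g_diff: "g (w, f) \<ominus> g (w', f') = g (w \<ominus> w', f \<ominus> f')"
      if "w \<in> W" "f \<in> F" "w' \<in> W" "f' \<in> F" for w f w' f'
      using that vR FR WR unfolding g_def by (simp, algebra)
    have inj: "inj_on g (W \<times> F)"
    proof (rule inj_onI)
      fix p p' assume p: "p \<in> W \<times> F" "p' \<in> W \<times> F" "g p = g p'"
      obtain w f w' f' where pp: "p = (w, f)" "p' = (w', f')" "w \<in> W" "f \<in> F" "w' \<in> W" "f' \<in> F"
        using p by auto
      define d where "d = f \<ominus> f'"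
      have d: "d \<in> F" unfolding d_def
        using additive_subgroup_minus_closed pp F.additive_subgroup_axioms by blast
      have ww: "w \<ominus> w' \<in> W"
        using additive_subgroup_minus_closed pp W.additive_subgroup_axioms by blast
      have "g (w \<ominus> w', d) = \<zero>"
        unfolding d_def using g_diff[of w f w' f'] p pp FR WR vR
        by (simp add: g_def r_neg minus_eq)
      then have 0: "(w \<ominus> w') \<oplus> d \<otimes> v = \<zero>" by (simp add: g_def)
      then have dv: "d \<otimes> v = \<ominus> (w \<ominus> w')"
        using WR[OF ww] FR[OF d] vR by (metis a_comm m_closed minus_equality)
      have "d = \<zero>"
      proof (rule ccontr)
        assume "d \<noteq> \<zero>"
        then have dU: "d \<in> Units R" using FR[OF d] Units_eq by auto
        have "inv d \<in> F" using d \<open>d \<noteq> \<zero>\<close> F by (simp add: division_subring_def)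
        then have "inv d \<otimes> (d \<otimes> v) \<in> W" using FW ww dv W.a_inv_closed by metis
        then show False using dU vR v(2) by (simp flip: m_assoc add: Units_closed)
      qed
      then have "f = f'" "w = w'"
        using pp FR WR vR 0 minus_eq_zeroD by (auto simp: d_def)
      then show "p = p'" by (simp add: pp)
    qed
    define W' where "W' = g ` (W \<times> F)"
    have "additive_subgroup W' R"
    proof (rule additive_subgroupI_minus)
      show "W' \<subseteq> carrier R" using FR WR vR by (auto simp: W'_def g_def)
      have "g (\<zero>, \<zero>) = \<zero>" using vR by (simp add: g_def)
      then show "\<zero> \<in> W'" unfolding W'_def using W.zero_closed F.zero_closed
        by (metis SigmaI image_eqI)
      show "x \<ominus> y \<in> W'" if "x \<in> W'" "y \<in> W'" for x y
        using that g_diff additive_subgroup_minus_closed[OF W.additive_subgroup_axioms]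
          additive_subgroup_minus_closed[OF F.additive_subgroup_axioms]
        unfolding W'_def by clarsimp
    qed
    moreover have "W' \<subseteq> V"
    proof -
      have "W \<subseteq> V" using W(1) by (simp add: \<S>_def)
      then show ?thesis using FV v(1) by (auto simp: W'_def g_def)
    qed
    moreover have "f \<otimes> x \<in> W'" if "f \<in> F" "x \<in> W'" for f x
    proof -
      obtain w e where "w \<in> W" "e \<in> F" "x = g (w, e)" using \<open>x \<in> W'\<close> by (auto simp: W'_def)
      then have "f \<otimes> x = g (f \<otimes> w, f \<otimes> e)"
        using FR WR vR \<open>f \<in> F\<close> by (simp add: g_def r_distr m_assoc)
      moreover have "f \<otimes> e \<in> F" using F \<open>f \<in> F\<close> \<open>e \<in> F\<close> by (simp add: division_subring_def)
      ultimately show ?thesis using FW \<open>f \<in> F\<close> \<open>w \<in> W\<close> by (auto simp: W'_def)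
    qed
    moreover have "card W' = card F ^ Suc m"
      unfolding W'_def card_image[OF inj] card_cartesian_product by (simp add: m)
    ultimately have "W' \<in> \<S>" unfolding \<S>_def by blast
    moreover have "W \<subseteq> W'"
    proof
      fix w assume "w \<in> W"
      then have "w = g (w, \<zero>)" using WR vR by (simp add: g_def)
      then show "w \<in> W'" unfolding W'_def using \<open>w \<in> W\<close> F.zero_closed by blast
    qed
    ultimately have "W' = W" using W(2) by blast
    moreover have "v = g (\<zero>, \<one>)" using vR by (simp add: g_def)
    then have "v \<in> W'" unfolding W'_def
      using F W.zero_closed by (auto simp: division_subring_def)
    ultimately show False using v(2) by simp
  qed
  with m show ?thesis by blast
qed

text \<open>
  With \<open>q\<close> the cardinality of the centre, the whole ring has \<open>q ^ n\<close> elements, and the centralizer of \<open>a\<close>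
  has \<open>q ^ k\<close> elements, where \<open>k\<close> divides \<open>n\<close> because the ring is a vector space over the
  centralizer. A noncentral \<open>a\<close> thus has \<open>(q ^ n - 1) / (q ^ k - 1)\<close> conjugates with \<open>k < n\<close>, a
  multiple of the cyclotomic divisor \<open>N\<close>. If the ring were not commutative, \<open>N\<close> would divide both
  the number \<open>q ^ n - q\<close> of noncentral elements and \<open>q ^ n - 1\<close>, hence \<open>q - 1\<close>.
\<close>

theorem wedderburn_commutative:
  assumes "x \<in> carrier R" "y \<in> carrier R"
  shows "x \<otimes> y = y \<otimes> x"
proof (rule ccontr)
  assume neq: "x \<otimes> y \<noteq> y \<otimes> x"
  have RR: "additive_subgroup (carrier R) R" by (intro additive_subgroupI_minus) auto
  define q where "q = card centre"
  have q: "q \<ge> 2"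
    unfolding q_def using card_division_subring_ge_2 division_subring_centre by blast
  obtain n where n: "card (carrier R) = q ^ n"
    using card_eq_power_card_division_subring[OF division_subring_centre RR]
    by (auto simp: q_def centre_def)
  have "x \<notin> centre" using neq assms by (auto simp: centre_def)
  then have "centre \<subset> carrier R" using assms(1) by (auto simp: centre_def)
  then have "card centre < card (carrier R)" by (rule psubset_card_mono[OF finite_carrier])
  then have "q < q ^ n" by (simp add: n flip: q_def)
  then have "q ^ 1 < q ^ n" by simp
  then have n2: "n \<ge> 2" using q by (subst (asm) power_strict_increasing_iff) auto
  obtain N :: int where N: "\<And>k. k dvd n \<Longrightarrow> k < n \<Longrightarrow> N * (int q ^ k - 1) dvd int q ^ n - 1"
    "\<not> N dvd int q - 1"
    using cyclotomic_divisor[OF q n2] by blast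
  define G where "G = units_of R"
  interpret G: group G unfolding G_def by (rule units_group)
  have carrier_G: "carrier G = carrier R - {\<zero>}" by (simp add: G_def units_of_carrier Units_eq)
  define \<phi> where "\<phi> = (\<lambda>g. \<lambda>h\<in>carrier G. g \<otimes>\<^bsub>G\<^esub> h \<otimes>\<^bsub>G\<^esub> inv\<^bsub>G\<^esub> g)"
  interpret conj: group_action G "carrier G" \<phi>
    unfolding \<phi>_def by (rule G.action_by_conjugation)
  have phi: "\<phi> g h = g \<otimes> h \<otimes> inv g" if "g \<in> carrier G" "h \<in> carrier G" for g h
    using that by (simp add: \<phi>_def G_def units_of_mult units_of_inv units_of_carrier)
  have phi_fix: "\<phi> g h = h \<longleftrightarrow> g \<otimes> h = h \<otimes> g" if "g \<in> carrier G" "h \<in> carrier G" for g h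
  proof -
    have gU: "g \<in> Units R" and hR: "h \<in> carrier R" and gR: "g \<in> carrier R"
      using that by (auto simp: carrier_G Units_eq)
    have "g \<otimes> h \<otimes> inv g = h \<longleftrightarrow> g \<otimes> h \<otimes> inv g \<otimes> g = h \<otimes> g"
      using gU gR hR by (metis Units_inv_closed Units_r_inv m_assoc m_closed r_one)
    then show ?thesis using gU gR hR by (simp add: phi that m_assoc)
  qed
  have order_G: "int (Coset.order G) = int q ^ n - 1"
    using finite_carrier q by (simp add: Coset.order_def carrier_G n Suc_leI)
  have dvd_orbit: "N dvd int (card (orbit G \<phi> a))" if a: "a \<in> carrier R - centre" for a
  proof -
    have aR: "a \<in> carrier R" and aG: "a \<in> carrier G"
      using a by (auto simp: carrier_G centre_def)
    note C = division_subring_centralizer[OF aR]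
    obtain k where k: "card (centralizer a) = q ^ k"
      using card_eq_power_card_division_subring[OF division_subring_centre, of "centralizer a"]
        C unfolding q_def division_subring_def centre_eq_Inter using aR by blast
    obtain m where "card (carrier R) = card (centralizer a) ^ m"
      using card_eq_power_card_division_subring[OF C RR] by (auto simp: centralizer_def)
    then have "q ^ n = q ^ (k * m)" using n k by (simp add: power_mult)
    then have "n = k * m" using q by simp
    obtain b where "b \<in> carrier R" "a \<otimes> b \<noteq> b \<otimes> a" using a by (auto simp: centre_def)
    then have "b \<in> carrier R - centralizer a" by (simp add: centralizer_def)
    then have "centralizer a \<subset> carrier R" by (auto simp: centralizer_def)
    then have "card (centralizer a) < card (carrier R)"
      by (rule psubset_card_mono[OF finite_carrier])
    then have "q ^ k < q ^ n" by (simp add: n k)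
    then have "k < n" using q by (subst (asm) power_strict_increasing_iff) auto
    have "stabilizer G \<phi> a = centralizer a - {\<zero>}"
      using aG by (auto simp: stabilizer_def phi_fix centralizer_def carrier_G)
    moreover have "\<zero> \<in> centralizer a" using aR by (simp add: centralizer_def)
    moreover have "finite (centralizer a)"
      using finite_carrier by (auto simp: centralizer_def)
    ultimately have "int (card (stabilizer G \<phi> a)) = int q ^ k - 1"
      using k q by (simp add: card_Diff_singleton )
    then have "int (card (orbit G \<phi> a)) * (int q ^ k - 1) = int q ^ n - 1"
      using conj.orbit_stabilizer_theorem[OF aG] order_G by (metis of_nat_mult)
    moreover have "N * (int q ^ k - 1) dvd int q ^ n - 1"
      using N(1) \<open>n = k * m\<close> \<open>k < n\<close> by simp
    moreover have "q ^ k \<ge> 2" using card_division_subring_ge_2[OF C] k by simp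
    then have "int q ^ k \<ge> 2" by (metis of_nat_le_iff of_nat_numeral of_nat_power)
    then have "int q ^ k - 1 \<noteq> 0" by simp
    ultimately show ?thesis by (metis dvd_mult_cancel_right)
  qed
  define A where "A = carrier R - centre"
  have AG: "A \<subseteq> carrier G" by (auto simp: A_def carrier_G centre_def)
  have orbit_A: "orbit G \<phi> a \<subseteq> A" if a: "a \<in> A" for a
  proof
    fix b assume b: "b \<in> orbit G \<phi> a"
    then have bG: "b \<in> carrier G" using a AG conj.element_image by (auto simp: orbit_def)
    show "b \<in> A"
    proof (rule ccontr)
      assume "b \<notin> A"
      then have bc: "b \<in> centre" using bG by (auto simp: A_def carrier_G)
      have "a \<in> orbit G \<phi> b" using conj.orbit_sym b bG a AG by blast
      then obtain g where g: "g \<in> carrier G" "a = \<phi> g b" by (auto simp: orbit_def)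
      then have "a = b" using phi_fix[OF g(1) bG] bc by (auto simp: centre_def carrier_G)
      then show False using a bc by (simp add: A_def)
    qed
  qed
  define r where "r = {(a, b). a \<in> A \<and> b \<in> orbit G \<phi> a}"
  have "equiv A r"
  proof (rule equivI)
    show "r \<subseteq> A \<times> A" using orbit_A by (auto simp: r_def)
    show "refl_on A r" using conj.orbit_refl AG by (auto simp: r_def refl_on_def)
    show "sym r" using conj.orbit_sym AG orbit_A by (auto simp: r_def sym_def) blast+
    show "trans r" using conj.orbit_trans AG orbit_A by (auto simp: r_def trans_def) blast+
  qed
  \<comment> \<open>The classes of \<open>r\<close> are the conjugacy classes that make up \<open>A\<close>.\<close>
  have "nat \<bar>N\<bar> dvd card A"
  proof (rule equiv_imp_dvd_card[OF _ \<open>equiv A r\<close>])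
    show "finite A" using finite_carrier by (simp add: A_def)
    fix X assume "X \<in> A // r"
    then obtain a where "a \<in> A" "X = orbit G \<phi> a" by (auto simp: quotient_def r_def)
    then show "nat \<bar>N\<bar> dvd card X" using dvd_orbit by (simp add: A_def)
  qed
  moreover have "int (card A) = int q ^ n - int q"
  proof -
    have "finite centre"
      using \<open>centre \<subset> carrier R\<close> finite_carrier by (auto intro: finite_subset)
    then have "card A = q ^ n - q"
      using \<open>centre \<subset> carrier R\<close> by (simp add: A_def card_Diff_subset n q_def)
    then show ?thesis using \<open>q < q ^ n\<close> by simp
  qed
  ultimately have "N dvd int q ^ n - int q" by simp
  moreover have "N dvd int q ^ n - 1"
    using N(1)[of 1] n2 by (auto dest: dvd_mult_left)
  ultimately have "N dvd (int q ^ n - 1) - (int q ^ n - int q)" by (metis dvd_diff)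
  then show False using N(2) by simp
qed

lemma is_field: "field R"
proof -
  have "cring R"
    using ring_axioms comm_monoid.intro[OF monoid_axioms] wedderburn_commutative
    by (simp add: cring_def comm_monoid_axioms_def)
  then show ?thesis using Units_eq by (rule cring.cring_fieldI)
qed

end


section \<open>The Salem bound for pairs\<close>

context finite_ring
begin

definition dot2 :: "'a \<times> 'a \<Rightarrow> 'a \<times> 'a \<Rightarrow> 'a" where
  "dot2 y x = fst y \<otimes> fst x \<oplus> snd y \<otimes> snd x"

definition incidences :: "('a \<times> 'a) set \<Rightarrow> 'a \<Rightarrow> 'a \<times> 'a \<Rightarrow> ('a \<times> 'a) set" where
  "incidences S t x = {y \<in> S. dot2 y x = t}"

text \<open>
  Functions of two coordinates are turned into functions of \<open>d\<close> coordinates by placing their mass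
  on vectors whose other coordinates vanish; the value of \<open>A_t\<close> at \<open>x\<close> then depends on the
  first two coordinates of \<open>x\<close> only. The restriction to \<open>{1..d}\<close> makes the padded vectors
  elements of \<^const>\<open>tuples\<close>.
\<close>

definition pad :: "nat \<Rightarrow> 'a \<times> 'a \<Rightarrow> nat \<Rightarrow> 'a" where
  "pad d p = (\<lambda>j\<in>{1..d}. if j = 1 then fst p else if j = 2 then snd p else \<zero>)"

definition first_two :: "(nat \<Rightarrow> 'a) \<Rightarrow> 'a \<times> 'a" where
  "first_two x = (x 1, x 2)"

lemma finite_tuples: "finite (tuples R d)"
  unfolding tuples_def using finite_carrier by (intro finite_PiE) auto

lemma pad_in_tuples: "p \<in> carrier R \<times> carrier R \<Longrightarrow> pad d p \<in> tuples R d"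
  by (auto simp: pad_def tuples_def)

lemma inj_pad:
  assumes "d \<ge> 2"
  shows "inj (pad d)"
proof (rule inj_on_inverseI)
  show "(\<lambda>x. (x 1, x 2)) (pad d p) = p" for p using assms by (simp add: pad_def)
qed

lemma first_two_in: "d \<ge> 2 \<Longrightarrow> x \<in> tuples R d \<Longrightarrow> first_two x \<in> carrier R \<times> carrier R"
  by (auto simp: first_two_def tuples_def)

lemma dot_pad:
  assumes d: "d \<ge> 2" and p: "p \<in> carrier R \<times> carrier R" and x: "x \<in> tuples R d"
  shows "dot R d (pad d p) x = dot2 p (first_two x)"
proof -
  have xR: "x j \<in> carrier R" if "j \<in> {1..d}" for j using x that by (auto simp: tuples_def)
  have yR: "pad d p j \<in> carrier R" if "j \<in> {1..d}" for j using p that by (auto simp: pad_def)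
  have split: "{1..d} = insert 1 (insert 2 {3..d})" using d by auto
  have rest: "(\<Oplus>j\<in>{3..d}. pad d p j \<otimes> x j) = \<zero>"
    using xR by (intro add.finprod_one_eqI) (auto simp: pad_def)
  have closed: "(\<lambda>j. pad d p j \<otimes> x j) \<in> {3..d} \<rightarrow> carrier R" using xR yR by auto
  have "dot R d (pad d p) x = pad d p 1 \<otimes> x 1 \<oplus> (pad d p 2 \<otimes> x 2 \<oplus> \<zero>)"
    unfolding dot_def split using d xR yR closed rest by (subst finsum_insert, auto)+
  then show ?thesis
    using d p xR by (auto simp: pad_def dot2_def first_two_def)
qed

lemma card_tuples_with_first_two:
  assumes d: "d \<ge> 2" and p: "p \<in> carrier R \<times> carrier R"
  shows "card {x \<in> tuples R d. first_two x = p} = card (carrier R) ^ (d - 2)"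
proof -
  have split: "{1..d} = insert 1 (insert 2 {3..d})" using d by auto
  define B where "B j = (if j = 1 then {fst p} else if j = 2 then {snd p} else carrier R)" for j :: nat
  have "{x \<in> tuples R d. first_two x = p} = (\<Pi>\<^sub>E j\<in>{1..d}. B j)"
  proof (intro equalityI subsetI)
    fix x assume "x \<in> {x \<in> tuples R d. first_two x = p}"
    then show "x \<in> (\<Pi>\<^sub>E j\<in>{1..d}. B j)"
      by (auto simp: tuples_def first_two_def B_def PiE_iff)
  next
    fix x assume x: "x \<in> (\<Pi>\<^sub>E j\<in>{1..d}. B j)"
    then have *: "x j \<in> B j" if "j \<in> {1..d}" for j using that by auto
    have "x 1 \<in> B 1" "x 2 \<in> B 2" using * d by auto
    then have "first_two x = p" by (simp add: B_def first_two_def)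
    moreover have "x j \<in> carrier R" if "j \<in> {1..d}" for j
      using *[OF that] p by (auto simp: B_def split: if_splits)
    ultimately show "x \<in> {x \<in> tuples R d. first_two x = p}"
      using x by (auto simp: tuples_def PiE_iff)
  qed
  also have "card \<dots> = (\<Prod>j\<in>{1..d}. card (B j))" by (rule card_PiE) simp
  also have "\<dots> = (\<Prod>j\<in>{3..d}. card (carrier R))"
    unfolding split by (simp add: B_def)
  also have "\<dots> = card (carrier R) ^ (d - 2)" by simp
  finally show ?thesis .
qed

lemma sum_first_two:
  fixes h :: "'a \<times> 'a \<Rightarrow> real"
  assumes "d \<ge> 2"
  shows "(\<Sum>x\<in>tuples R d. h (first_two x))
    = real (card (carrier R)) ^ (d - 2) * (\<Sum>p\<in>carrier R \<times> carrier R. h p)"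
proof -
  have "(\<Sum>x\<in>tuples R d. h (first_two x))
      = (\<Sum>p\<in>carrier R \<times> carrier R. of_nat (card {x \<in> tuples R d. first_two x = p}) * h p)"
    using finite_tuples finite_carrier first_two_in[OF assms]
    by (intro sum_fun_comp image_subsetI) simp_all
  also have "\<dots> = (\<Sum>p\<in>carrier R \<times> carrier R. real (card (carrier R)) ^ (d - 2) * h p)"
    using card_tuples_with_first_two[OF assms] by (intro sum.cong) auto
  finally show ?thesis by (simp add: sum_distrib_left)
qed

end

locale salem_ring = finite_ring +
  fixes d :: nat and t :: 'a and C :: real
  assumes d_ge_2: "d \<ge> 2"
    and t_unit: "t \<in> Units R"
    and salem: "salem_bound R d t C"
begin

text \<open>
  This is the Salem bound for \<open>1\<^sub>S - 1\<^sub>T\<close>, padded by zeros. Padding multiplies the left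
  side by the number \<open>|R| ^ (d - 2)\<close> of tuples with given first two coordinates, and the bound has the factor
  \<open>|R| ^ (d - 1)\<close>, so one factor \<open>|R|\<close> remains, independent of \<open>d\<close>. The set \<open>T\<close> only serves to
  make the mean zero; \<open>B\<close> collects points at which it contributes nothing.
\<close>

lemma salem_pairs:
  assumes S: "S \<subseteq> carrier R \<times> carrier R" and T: "T \<subseteq> carrier R \<times> carrier R"
    and card_eq: "card S = card T"
    and B: "B \<subseteq> carrier R \<times> carrier R"
    and no_T: "\<And>x y. x \<in> B \<Longrightarrow> y \<in> T \<Longrightarrow> dot2 y x \<noteq> t"
  shows "(\<Sum>x\<in>B. (real (card (incidences S t x)))\<^sup>2) \<le> 2 * C\<^sup>2 * card (carrier R) * card S"
proof -
  note inj = inj_pad[OF d_ge_2]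
  define q where "q = real (card (carrier R))"
  have "card (carrier R) > 0" using finite_carrier by (auto simp: card_gt_0_iff)
  then have q: "q > 0" by (simp add: q_def)
  define f where "f y = (of_bool (y \<in> pad d ` S) - of_bool (y \<in> pad d ` T) :: complex)" for y
  have pad_sub: "pad d ` P \<subseteq> tuples R d" if "P \<subseteq> carrier R \<times> carrier R" for P
    using pad_in_tuples that by blast
  have sum_ind: "(\<Sum>y\<in>tuples R d. of_bool (y \<in> pad d ` P)) = (of_nat (card P) :: 'c :: semiring_1)"
    if "P \<subseteq> carrier R \<times> carrier R" for P
  proof -
    have "tuples R d \<inter> pad d ` P = pad d ` P" using pad_sub[OF that] by blast
    then show ?thesis
      using finite_tuples card_image[OF inj_on_subset[OF inj subset_UNIV], of P] by simp
  qed
  have "mean_zero R d f"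
    unfolding mean_zero_def f_def by (simp add: sum_subtractf sum_ind S T card_eq del: sum_of_bool_eq)
  then have bound: "norm2 R d (A_op R d t f) \<le> C * q powr ((real d - 1) / 2) * norm2 R d f"
    using salem by (simp add: salem_bound_def q_def)
  have norm2_sq: "(norm2 R d g)\<^sup>2 = (\<Sum>x\<in>tuples R d. (cmod (g x))\<^sup>2)" for g
    unfolding norm2_def by (simp add: sum_nonneg)
  have norm_f: "(norm2 R d f)\<^sup>2 \<le> 2 * card S"
  proof -
    have "(norm2 R d f)\<^sup>2 \<le> (\<Sum>y\<in>tuples R d. of_bool (y \<in> pad d ` S) + of_bool (y \<in> pad d ` T))"
      unfolding norm2_sq by (intro sum_mono) (auto simp: f_def)
    then show ?thesis by (simp add: sum.distrib sum_ind S T card_eq del: sum_of_bool_eq)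
  qed
  have A_part: "(\<Sum>y\<in>{y \<in> tuples R d. dot R d y x = t}. of_bool (y \<in> pad d ` P))
      = (of_nat (card (incidences P t (first_two x))) :: complex)"
    if P: "P \<subseteq> carrier R \<times> carrier R" and x: "x \<in> tuples R d" for P x
  proof -
    have "{y \<in> tuples R d. dot R d y x = t} \<inter> pad d ` P = pad d ` incidences P t (first_two x)"
      using pad_sub[OF P] dot_pad[OF d_ge_2 _ x] P by (auto simp: incidences_def)
    then show ?thesis
      using finite_tuples card_image[OF inj_on_subset[OF inj subset_UNIV]] by simp
  qed
  have A_f: "A_op R d t f x = of_nat (card (incidences S t (first_two x)))
       - of_nat (card (incidences T t (first_two x)))" if "x \<in> tuples R d" for x
    unfolding A_op_def f_def by (simp only: sum_subtractf A_part S T that)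
  define h where "h p = (if p \<in> B then (real (card (incidences S t p)))\<^sup>2 else 0)" for p
  have "q ^ (d - 2) * (\<Sum>x\<in>B. (real (card (incidences S t x)))\<^sup>2)
      = q ^ (d - 2) * (\<Sum>p\<in>carrier R \<times> carrier R. h p)"
    unfolding h_def using finite_carrier B by (simp add: sum.If_cases Int_absorb1)
  also have "\<dots> = (\<Sum>x\<in>tuples R d. h (first_two x))"
    unfolding q_def by (rule sum_first_two[OF d_ge_2, symmetric])
  also have "\<dots> \<le> (\<Sum>x\<in>tuples R d. (cmod (A_op R d t f x))\<^sup>2)"
  proof (rule sum_mono)
    fix x assume x: "x \<in> tuples R d"
    show "h (first_two x) \<le> (cmod (A_op R d t f x))\<^sup>2"
    proof (cases "first_two x \<in> B")
      case True
      then have "incidences T t (first_two x) = {}" using no_T by (auto simp: incidences_def)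
      then show ?thesis using x by (simp add: h_def A_f)
    qed (simp add: h_def)
  qed
  also have "\<dots> = (norm2 R d (A_op R d t f))\<^sup>2" by (simp add: norm2_sq)
  also have "\<dots> \<le> (C * q powr ((real d - 1) / 2) * norm2 R d f)\<^sup>2"
    using bound by (intro power_mono) (auto simp: norm2_def sum_nonneg)
  also have "\<dots> = C\<^sup>2 * q ^ (d - 1) * (norm2 R d f)\<^sup>2"
  proof -
    have "(q powr ((real d - 1) / 2))\<^sup>2 = q powr (real (d - 1))"
      using d_ge_2 by (simp add: power2_eq_square flip: powr_add)
    also have "\<dots> = q ^ (d - 1)" using q by (simp add: powr_realpow)
    finally show ?thesis by (simp add: power_mult_distrib)
  qed
  also have "\<dots> \<le> C\<^sup>2 * q ^ (d - 1) * (2 * card S)"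
    using norm_f q by (intro mult_left_mono) auto
  also have "q ^ (d - 1) = q ^ (d - 2) * q"
  proof -
    have "d - 1 = Suc (d - 2)" using d_ge_2 by simp
    then show ?thesis by (simp add: mult.commute)
  qed
  finally have "q ^ (d - 2) * (\<Sum>x\<in>B. (real (card (incidences S t x)))\<^sup>2)
      \<le> q ^ (d - 2) * (2 * C\<^sup>2 * q * card S)" by (simp add: mult_ac)
  then show ?thesis using q by (simp add: q_def)
qed

end


section \<open>Right ideals of finite rings\<close>

lemma card_le_card_image_times:
  assumes "finite A" "\<And>a. a \<in> A \<Longrightarrow> card {b \<in> A. f b = f a} \<le> m"
  shows "card A \<le> card (f ` A) * m"
proof -
  have "card A = card (\<Union>y\<in>f ` A. {b \<in> A. f b = y})" by (rule arg_cong[of _ _ card]) auto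
  also have "\<dots> \<le> (\<Sum>y\<in>f ` A. card {b \<in> A. f b = y})" using assms(1) by (intro card_UN_le) simp
  also have "\<dots> \<le> (\<Sum>y\<in>f ` A. m)" using assms(2) by (intro sum_mono) auto
  finally show ?thesis by simp
qed

context finite_ring
begin

text \<open>
  Multiplication by an element on the left is an injection of a finite set into itself as soon as it
  has a left inverse or a trivial kernel, and then it is onto. So in a finite ring one-sided inverses
  are two-sided, and nonunits have nonzero right annihilators.
\<close>

lemma mult_one_imp_Units:
  assumes "a \<in> carrier R" "b \<in> carrier R" "a \<otimes> b = \<one>"
  shows "a \<in> Units R" "b \<in> Units R"
proof -
  have "inj_on (\<lambda>x. b \<otimes> x) (carrier R)"
    using assms by (intro inj_on_inverseI[of _ "\<lambda>x. a \<otimes> x"]) (simp flip: m_assoc)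
  then have "(\<lambda>x. b \<otimes> x) ` carrier R = carrier R"
    using finite_carrier assms by (intro endo_inj_surj) auto
  then obtain c where c: "c \<in> carrier R" "b \<otimes> c = \<one>" using one_closed by (metis imageE)
  have "c = a \<otimes> b \<otimes> c" using assms c by simp
  also have "\<dots> = a" using assms(1,2) c by (simp add: m_assoc)
  finally have "b \<otimes> a = \<one>" using c by simp
  then show "a \<in> Units R" "b \<in> Units R" using assms by (auto simp: Units_def)
qed

lemma Units_if_no_right_annihilator:
  assumes a: "a \<in> carrier R" and ann: "\<And>r. r \<in> carrier R \<Longrightarrow> a \<otimes> r = \<zero> \<Longrightarrow> r = \<zero>"
  shows "a \<in> Units R"
proof -
  have "inj_on (\<lambda>x. a \<otimes> x) (carrier R)"
  proof (rule inj_onI)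
    fix x y assume xy: "x \<in> carrier R" "y \<in> carrier R" "a \<otimes> x = a \<otimes> y"
    then have "a \<otimes> (x \<ominus> y) = \<zero>" using a by (simp add: minus_eq r_distr r_minus r_neg)
    then show "x = y" using ann xy minus_eq_zeroD by simp
  qed
  then have "(\<lambda>x. a \<otimes> x) ` carrier R = carrier R"
    using finite_carrier a by (intro endo_inj_surj) auto
  then obtain c where "c \<in> carrier R" "a \<otimes> c = \<one>" using one_closed by (metis imageE)
  then show ?thesis using mult_one_imp_Units a by blast
qed

text \<open>
  The typical \<open>f\<close> is additive with kernel \<open>X\<close>; every fibre of \<open>f\<close> then has at most \<open>|X|\<close> elements.
\<close>

lemma card_carrier_le_image_times:
  assumes X: "X \<subseteq> carrier R"
    and f: "\<And>r s. r \<in> carrier R \<Longrightarrow> s \<in> carrier R \<Longrightarrow> f r = f s \<Longrightarrow> r \<ominus> s \<in> X"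
  shows "card (carrier R) \<le> card (f ` carrier R) * card X"
proof (rule card_le_card_image_times[OF finite_carrier])
  fix a assume a: "a \<in> carrier R"
  show "card {b \<in> carrier R. f b = f a} \<le> card X"
  proof (rule card_inj_on_le)
    show "inj_on (\<lambda>b. b \<ominus> a) {b \<in> carrier R. f b = f a}"
      using a by (auto intro!: inj_onI simp: minus_eq)
    show "(\<lambda>b. b \<ominus> a) ` {b \<in> carrier R. f b = f a} \<subseteq> X" using f a by auto
    show "finite X" using X finite_carrier by (rule finite_subset)
  qed
qed

definition right_ideal :: "'a set \<Rightarrow> bool" where
  "right_ideal M \<longleftrightarrow> additive_subgroup M R \<and> (\<forall>m\<in>M. \<forall>r\<in>carrier R. m \<otimes> r \<in> M)"

lemma right_idealD:
  assumes "right_ideal M"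
  shows "M \<subseteq> carrier R" "\<zero> \<in> M" "finite M"
    "\<And>x y. x \<in> M \<Longrightarrow> y \<in> M \<Longrightarrow> x \<oplus> y \<in> M"
    "\<And>x y. x \<in> M \<Longrightarrow> y \<in> M \<Longrightarrow> x \<ominus> y \<in> M"
    "\<And>x. x \<in> M \<Longrightarrow> \<ominus> x \<in> M"
    "\<And>m r. m \<in> M \<Longrightarrow> r \<in> carrier R \<Longrightarrow> m \<otimes> r \<in> M"
proof -
  interpret M: additive_subgroup M R using assms by (simp add: right_ideal_def)
  show "M \<subseteq> carrier R" by (rule M.a_subset)
  then show "finite M" using finite_carrier by (rule finite_subset)
  show "\<zero> \<in> M" by (rule M.zero_closed)
  show "\<And>x y. x \<in> M \<Longrightarrow> y \<in> M \<Longrightarrow> x \<oplus> y \<in> M" "\<And>x. x \<in> M \<Longrightarrow> \<ominus> x \<in> M" by auto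
  show "\<And>x y. x \<in> M \<Longrightarrow> y \<in> M \<Longrightarrow> x \<ominus> y \<in> M"
    using additive_subgroup_minus_closed M.additive_subgroup_axioms by blast
  show "\<And>m r. m \<in> M \<Longrightarrow> r \<in> carrier R \<Longrightarrow> m \<otimes> r \<in> M"
    using assms by (simp add: right_ideal_def)
qed

definition principal :: "'a \<Rightarrow> 'a set" where
  "principal k = (\<lambda>r. k \<otimes> r) ` carrier R"

lemma right_ideal_principal:
  assumes k: "k \<in> carrier R"
  shows "right_ideal (principal k)"
  unfolding right_ideal_def
proof (intro conjI ballI additive_subgroupI_minus)
  show "principal k \<subseteq> carrier R" using k by (auto simp: principal_def)
  show "\<zero> \<in> principal k"
    unfolding principal_def by (rule image_eqI[of _ _ \<zero>]) (use k in simp_all)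
  show "x \<ominus> y \<in> principal k" if xy: "x \<in> principal k" "y \<in> principal k" for x y
  proof -
    obtain r where "x = k \<otimes> r" "r \<in> carrier R"
      using xy(1) by (auto simp: principal_def)
    moreover obtain s where "y = k \<otimes> s" "s \<in> carrier R"
      using xy(2) by (auto simp: principal_def)
    ultimately have "x \<ominus> y = k \<otimes> (r \<ominus> s)" "r \<ominus> s \<in> carrier R"
      using k by (simp_all add: minus_eq r_distr r_minus)
    then show ?thesis by (simp add: principal_def)
  qed
  show "m \<otimes> r \<in> principal k" if "m \<in> principal k" "r \<in> carrier R" for m r
    using that k by (auto simp: principal_def m_assoc)
qed

text \<open>
  An atom is a generator of a minimal right ideal: every nonzero element of \<open>k R\<close> generates \<open>k\<close> back.
\<close>

definition atom :: "'a \<Rightarrow> bool" where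
  "atom k \<longleftrightarrow> k \<in> carrier R \<and> k \<noteq> \<zero> \<and> (\<forall>r\<in>carrier R. k \<otimes> r \<noteq> \<zero> \<longrightarrow> k \<in> principal (k \<otimes> r))"

lemma in_principal_self: "k \<in> carrier R \<Longrightarrow> k \<in> principal k"
  unfolding principal_def by (rule image_eqI[of _ _ \<one>]) simp_all

text \<open>
  Among the nonzero right ideals \<open>r s R\<close> one of least cardinality is minimal.
\<close>

lemma ex_atom:
  assumes r: "r \<in> carrier R" "r \<noteq> \<zero>"
  obtains s where "s \<in> carrier R" "atom (r \<otimes> s)"
proof -
  have "\<one> \<in> carrier R \<and> r \<otimes> \<one> \<noteq> \<zero>" using r by simp
  from ex_has_least_nat[of "\<lambda>s. s \<in> carrier R \<and> r \<otimes> s \<noteq> \<zero>", OF this,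
      of "\<lambda>s. card (principal (r \<otimes> s))"]
  obtain s where s: "s \<in> carrier R" "r \<otimes> s \<noteq> \<zero>"
    and min: "\<And>u. u \<in> carrier R \<Longrightarrow> r \<otimes> u \<noteq> \<zero> \<Longrightarrow> card (principal (r \<otimes> s)) \<le> card (principal (r \<otimes> u))"
    by blast
  have "r \<otimes> s \<in> principal (r \<otimes> s \<otimes> u)" if u: "u \<in> carrier R" "r \<otimes> s \<otimes> u \<noteq> \<zero>" for u
  proof -
    have "principal (r \<otimes> s \<otimes> u) \<subseteq> principal (r \<otimes> s)"
      using r s u by (auto simp: principal_def m_assoc)
    moreover have "card (principal (r \<otimes> s)) \<le> card (principal (r \<otimes> s \<otimes> u))"
      using min[of "s \<otimes> u"] r s u by (simp add: m_assoc)
    moreover have "finite (principal (r \<otimes> s))" using finite_carrier by (simp add: principal_def)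
    ultimately have "principal (r \<otimes> s \<otimes> u) = principal (r \<otimes> s)"
      by (metis card_seteq)
    then show ?thesis using in_principal_self r s by simp
  qed
  then have "atom (r \<otimes> s)" using r s by (simp add: atom_def)
  then show ?thesis using that s by blast
qed

lemma atom_mult_left:
  assumes k: "atom k" and r: "r \<in> carrier R" "r \<otimes> k \<noteq> \<zero>"
  shows "atom (r \<otimes> k)"
proof -
  have kR: "k \<in> carrier R" using k by (simp add: atom_def)
  have "r \<otimes> k \<in> principal (r \<otimes> k \<otimes> u)" if u: "u \<in> carrier R" "r \<otimes> k \<otimes> u \<noteq> \<zero>" for u
  proof -
    have "k \<otimes> u \<noteq> \<zero>" using u r kR by (auto simp: m_assoc)
    then obtain v where v: "v \<in> carrier R" "k = k \<otimes> u \<otimes> v"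
      using k u by (auto simp: atom_def principal_def)
    have "r \<otimes> k = r \<otimes> (k \<otimes> u \<otimes> v)" using v by simp
    also have "\<dots> = r \<otimes> k \<otimes> u \<otimes> v" using r kR u v(1) by (simp add: m_assoc)
    finally show ?thesis using v(1) by (simp add: principal_def)
  qed
  then show ?thesis using r kR by (simp add: atom_def)
qed

lemma atom_in_principal_of_mem:
  assumes k: "atom k" and r: "r \<in> principal k" "r \<noteq> \<zero>"
  shows "principal k \<subseteq> principal r"
proof -
  have kR: "k \<in> carrier R" using k by (simp add: atom_def)
  obtain u where u: "u \<in> carrier R" "r = k \<otimes> u" using r by (auto simp: principal_def)
  then have "k \<in> principal r" using k r by (simp add: atom_def)
  moreover have "r \<in> carrier R" using u kR by simp
  ultimately show ?thesis using right_idealD(7)[OF right_ideal_principal]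
    by (auto simp: principal_def[of k])
qed

text \<open>
  If the ring is a minimal right ideal of itself, then every nonzero element generates \<open>1\<close>, that is, has
  a right inverse.
\<close>

lemma Units_eq_if_atom_generates:
  assumes k: "atom k" and one: "\<one> \<in> principal k"
  shows "Units R = carrier R - {\<zero>}"
proof (intro equalityI subsetI)
  fix a assume "a \<in> Units R"
  then show "a \<in> carrier R - {\<zero>}" using one_not_zero by (auto simp: Units_def)
next
  fix a assume a: "a \<in> carrier R - {\<zero>}"
  have kR: "k \<in> carrier R" using k by (simp add: atom_def)
  have "a = \<one> \<otimes> a" using a by simp
  then have "a \<in> principal k" using right_idealD(7)[OF right_ideal_principal[OF kR] one] a by auto
  then have "\<one> \<in> principal a" using atom_in_principal_of_mem[OF k] a one by blast
  then obtain c where "c \<in> carrier R" "a \<otimes> c = \<one>" by (auto simp: principal_def)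
  then show "a \<in> Units R" using mult_one_imp_Units a by blast
qed

end

section \<open>Bounds for rings with the Salem property\<close>

context salem_ring
begin

abbreviation K :: real where "K \<equiv> 2 * C\<^sup>2"

text \<open>
  With \<open>U\<close> the set to be bounded, the Salem bound is applied to \<open>S = (1 + U) \<times> M\<close> and
  \<open>T = U \<times> M\<close>. Vectors in \<open>T\<close> have products in the proper ideal \<open>M\<close>, never equal to the unit
  \<open>t\<close>. For \<open>(u, m') \<in> S\<close> and arbitrary \<open>r\<close> the equation \<open>u x + m' r = t\<close> has the solution
  \<open>x = u\<^sup>-\<^sup>1 (t - m' r)\<close>, and \<open>x \<in> t + M\<close> because \<open>u \<in> 1 + M\<close>. So at least
  \<open>|S| |R|\<close> incidences are concentrated on the \<open>|M| |R|\<close> points of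
  \<open>B = (t + M) \<times> R\<close>, and by Cauchy-Schwarz the sum of squares is at least
  \<open>|S|\<^sup>2 |R| / |M| = |U| |R| |S|\<close>.
\<close>

lemma card_units_one_plus_right_ideal:
  assumes M: "right_ideal M" and one: "\<one> \<notin> M"
  shows "card {m \<in> M. \<one> \<oplus> m \<in> Units R} \<le> K"
proof -
  note M' = right_idealD[OF M]
  have MR: "m \<in> carrier R" if "m \<in> M" for m using that M'(1) by blast
  have tR: "t \<in> carrier R" using t_unit by (rule Units_closed)
  have t_notin: "t \<notin> M"
    using M'(7)[of t "inv t"] t_unit one by auto
  define U where "U = {m \<in> M. \<one> \<oplus> m \<in> Units R}"
  have UM: "U \<subseteq> M" by (auto simp: U_def)
  have finU: "finite U" using UM M'(3) by (rule finite_subset)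
  define S where "S = ((\<lambda>m. \<one> \<oplus> m) ` U) \<times> M"
  define T where "T = U \<times> M"
  define B where "B = (\<lambda>(m, r). (m \<oplus> t, r)) ` (M \<times> carrier R)"
  have inj: "inj_on (\<lambda>m. \<one> \<oplus> m) U" using UM MR by (intro inj_onI) (auto simp: subset_iff)
  have cardS: "card S = card U * card M"
    unfolding S_def by (simp add: card_cartesian_product card_image[OF inj])
  have finS: "finite S" using finU M'(3) by (simp add: S_def)
  have BR: "B \<subseteq> carrier R \<times> carrier R" using MR tR by (auto simp: B_def)
  have finB: "finite B" using M'(3) finite_carrier by (simp add: B_def)
  have cardB: "card B \<le> card M * card (carrier R)"
    unfolding B_def using M'(3) finite_carrier
    by (metis card_cartesian_product card_image_le finite_cartesian_product)
  have energy: "(\<Sum>x\<in>B. (real (card (incidences S t x)))\<^sup>2) \<le> K * card (carrier R) * card S"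
  proof (rule salem_pairs)
    show "S \<subseteq> carrier R \<times> carrier R" "T \<subseteq> carrier R \<times> carrier R"
      using MR UM by (auto simp: S_def T_def)
    show "card S = card T" by (simp add: cardS T_def card_cartesian_product)
    show "B \<subseteq> carrier R \<times> carrier R" by (rule BR)
    show "dot2 y x \<noteq> t" if "x \<in> B" "y \<in> T" for x y
    proof -
      have "dot2 y x \<in> M" unfolding dot2_def
        using that BR UM by (intro M'(4) M'(7)) (auto simp: T_def)
      then show ?thesis using t_notin by auto
    qed
  qed
  have per_y: "card (carrier R) \<le> card {x \<in> B. dot2 y x = t}" if "y \<in> S" for y
  proof -
    have "fst y \<in> (\<lambda>m. \<one> \<oplus> m) ` U" "snd y \<in> M" using that by (simp_all add: S_def mem_Times_iff)
    then obtain m m' where y: "y = (\<one> \<oplus> m, m')" "m \<in> U" "m' \<in> M" by (metis imageE prod.collapse)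
    define u where "u = \<one> \<oplus> m"
    have u: "u \<in> Units R" and uR: "u \<in> carrier R"
      using y(2) by (auto simp: U_def u_def Units_closed)
    have mR: "m \<in> carrier R" "m' \<in> carrier R" "m \<in> M" using y UM MR by auto
    define g where "g r = (inv u \<otimes> (t \<ominus> m' \<otimes> r), r)" for r
    show ?thesis
    proof (rule card_inj_on_le)
      show "inj_on g (carrier R)" by (auto simp: g_def intro: inj_onI)
      show "finite {x \<in> B. dot2 y x = t}" using finB by simp
      show "g ` carrier R \<subseteq> {x \<in> B. dot2 y x = t}"
      proof (intro image_subsetI CollectI conjI)
        fix r assume r: "r \<in> carrier R"
        define x where "x = inv u \<otimes> (t \<ominus> m' \<otimes> r)"
        have xR: "x \<in> carrier R" using u r mR tR by (simp add: x_def)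
        have ux: "u \<otimes> x = t \<ominus> m' \<otimes> r"
          using u uR r mR tR by (simp add: x_def flip: m_assoc)
        have "dot2 y (g r) = u \<otimes> x \<oplus> m' \<otimes> r" by (simp add: dot2_def y g_def u_def x_def)
        then show "dot2 y (g r) = t"
          unfolding ux using r mR tR by (simp add: minus_eq a_assoc l_neg)
        have "x \<oplus> m \<otimes> x = t \<ominus> m' \<otimes> r" using ux xR mR by (simp add: u_def l_distr)
        moreover have "x = (x \<oplus> m \<otimes> x) \<ominus> m \<otimes> x"
          using xR mR by (simp add: minus_eq a_assoc r_neg)
        ultimately have "x = (t \<ominus> m' \<otimes> r) \<ominus> m \<otimes> x" by simp
        also have "\<dots> = \<ominus> (m' \<otimes> r) \<ominus> m \<otimes> x \<oplus> t"
          using xR mR r tR by (simp add: minus_eq a_ac)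
        finally have "x = \<ominus> (m' \<otimes> r) \<ominus> m \<otimes> x \<oplus> t" .
        moreover have "\<ominus> (m' \<otimes> r) \<ominus> m \<otimes> x \<in> M"
          using y mR r xR by (intro M'(5) M'(6) M'(7))
        ultimately show "g r \<in> B"
          unfolding B_def g_def x_def[symmetric] using r
          by (intro image_eqI[of _ _ "(\<ominus> (m' \<otimes> r) \<ominus> m \<otimes> x, r)"]) auto
      qed
    qed
  qed
  have "real (card S * card (carrier R)) \<le> (\<Sum>x\<in>B. real (card (incidences S t x)))"
  proof -
    have "card S * card (carrier R) \<le> (\<Sum>y\<in>S. card {x \<in> B. dot2 y x = t})"
      using sum_mono[of S "\<lambda>_. card (carrier R)"] per_y by simp
    also have "\<dots> = (\<Sum>x\<in>B. card (incidences S t x))"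
      unfolding incidences_def using finS finB by (intro sum_multicount_gen) auto
    finally show ?thesis by (metis of_nat_mono of_nat_sum)
  qed
  then have "(real (card S * card (carrier R)))\<^sup>2 \<le> (\<Sum>x\<in>B. real (card (incidences S t x)))\<^sup>2"
    by (intro power_mono) auto
  also have "\<dots> \<le> (\<Sum>x\<in>B. (real (card (incidences S t x)))\<^sup>2) * card B"
    by (rule sum_squared_le_sum_of_squares)
  also have "\<dots> \<le> (K * card (carrier R) * card S) * (card M * card (carrier R))"
    using energy cardB by (intro mult_mono) (auto simp flip: of_nat_mult intro: sum_nonneg)
  finally have "(card U * card M * card (carrier R) * card M * card (carrier R)) * real (card U)
      \<le> (card U * card M * card (carrier R) * card M * card (carrier R)) * K"
    by (simp add: cardS power2_eq_square mult_ac)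
  moreover have "real (card U * card M * card (carrier R) * card M * card (carrier R)) > 0"
  proof -
    have "\<zero> \<in> U" using M'(2) by (simp add: U_def)
    then have "U \<noteq> {}" "M \<noteq> {}" "carrier R \<noteq> {}" using M'(2) by auto
    then show ?thesis using finU M'(3) finite_carrier by (simp add: card_gt_0_iff)
  qed
  ultimately show ?thesis unfolding U_def[symmetric] by (metis mult_le_cancel_left_pos)
qed

text \<open>
  The lines \<open>S = {1} \<times> R\<close> and \<open>T = {0} \<times> R\<close> are compared on the points \<open>(x\<^sub>1, x\<^sub>2)\<close> with
  \<open>x\<^sub>2\<close> not a unit, where \<open>r x\<^sub>2 = t\<close> is impossible. Each \<open>r\<close> and each pair with \<open>k z = 0\<close>, \<open>k \<noteq> 0\<close>
  yield the point \<open>(t - r z, z)\<close>, which is incident with both \<open>(1, r)\<close> and \<open>(1, r + k)\<close>.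
\<close>

lemma card_zero_products:
  "card {(k, z). k \<in> carrier R \<and> z \<in> carrier R \<and> k \<noteq> \<zero> \<and> k \<otimes> z = \<zero>} \<le> K * card (carrier R)"
proof -
  have tR: "t \<in> carrier R" using t_unit by (rule Units_closed)
  define Z where "Z = {(k, z). k \<in> carrier R \<and> z \<in> carrier R \<and> k \<noteq> \<zero> \<and> k \<otimes> z = \<zero>}"
  define S where "S = {\<one>} \<times> carrier R"
  define T where "T = {\<zero>} \<times> carrier R"
  define B where "B = carrier R \<times> (carrier R - Units R)"
  have energy: "(\<Sum>x\<in>B. (real (card (incidences S t x)))\<^sup>2) \<le> K * card (carrier R) * card S"
  proof (rule salem_pairs[where T = T])
    show "dot2 y x \<noteq> t" if "x \<in> B" "y \<in> T" for x y
    proof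
      assume *: "dot2 y x = t"
      have xy: "fst x \<in> carrier R" "snd x \<in> carrier R" "snd x \<notin> Units R"
        "fst y = \<zero>" "snd y \<in> carrier R"
        using that by (auto simp: B_def T_def)
      have "snd y \<otimes> snd x = t" using * xy by (simp add: dot2_def)
      then have "inv t \<otimes> snd y \<otimes> snd x = \<one>" using xy t_unit by (simp add: m_assoc)
      then show False using mult_one_imp_Units(2)[of "inv t \<otimes> snd y" "snd x"] xy t_unit by simp
    qed
  qed (auto simp: S_def T_def B_def card_cartesian_product)
  define Q where "Q = (SIGMA x:B. incidences S t x \<times> incidences S t x)"
  have fin: "finite B" "finite S" using finite_carrier by (auto simp: B_def S_def)
  then have fin_inc: "finite (incidences S t x)" for x by (simp add: incidences_def)
  have cardQ: "real (card Q) = (\<Sum>x\<in>B. (real (card (incidences S t x)))\<^sup>2)"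
    unfolding Q_def using fin fin_inc
    by (subst card_SigmaI) (auto simp: card_cartesian_product power2_eq_square)
  define g where "g = (\<lambda>(r, k, z). ((t \<ominus> r \<otimes> z, z), (\<one>, r), (\<one>, r \<oplus> k)))"
  have "card (carrier R \<times> Z) \<le> card Q"
  proof (rule card_inj_on_le)
    show "finite Q" using fin fin_inc by (simp add: Q_def)
    show "inj_on g (carrier R \<times> Z)" by (rule inj_onI) (auto simp: g_def Z_def)
    show "g ` (carrier R \<times> Z) \<subseteq> Q"
    proof (rule image_subsetI)
      fix p assume "p \<in> carrier R \<times> Z"
      then obtain r k z where p: "p = (r, k, z)" and r: "r \<in> carrier R" and "(k, z) \<in> Z"
        by auto
      then have kz: "k \<in> carrier R" "z \<in> carrier R" "k \<noteq> \<zero>" "k \<otimes> z = \<zero>" by (auto simp: Z_def)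
      have "z \<notin> Units R"
      proof
        assume "z \<in> Units R"
        then have "k = k \<otimes> z \<otimes> inv z" using kz(1,2) by (simp add: m_assoc)
        then show False using kz \<open>z \<in> Units R\<close> by simp
      qed
      moreover have "t \<ominus> r \<otimes> z \<oplus> r \<otimes> z = t"
        using r kz tR by (simp add: minus_eq a_assoc l_neg)
      ultimately show "g p \<in> Q"
        using r kz tR
        by (simp add: p g_def Q_def B_def incidences_def S_def dot2_def l_distr)
    qed
  qed
  then have "real (card (carrier R)) * card Z \<le> card Q"
    unfolding card_cartesian_product by (metis of_nat_le_iff of_nat_mult)
  also have "\<dots> \<le> real (card (carrier R)) * (K * card (carrier R))"
    using energy cardQ by (simp add: S_def card_cartesian_product mult_ac)
  finally show ?thesis
    unfolding Z_def[symmetric] using finite_carrier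
    by (subst (asm) mult_le_cancel_left_pos) (auto simp: card_gt_0_iff)
qed

text \<open>
  By Schur's lemma, left multiplication by \<open>1 + w\<close> on the minimal right ideal \<open>P\<close> is injective or
  zero, and a right annihilator of \<open>1 + w\<close> lies in \<open>P\<close>. So the \<open>w \<in> P\<close> for which \<open>1 + w\<close> is not a
  unit act as \<open>-1\<close>. The difference of two of them acts as \<open>0 \<noteq> -1\<close>; translation therefore injects them
  into the set \<open>U\<close> of the other elements, which has at most \<open>K\<close> members.
\<close>

lemma card_minimal_right_ideal:
  assumes k: "atom k" and one: "\<one> \<notin> principal k"
  shows "card (principal k) \<le> 2 * K"
proof -
  define P where "P = principal k"
  have kR: "k \<in> carrier R" using k by (simp add: atom_def)
  note P' = right_idealD[OF right_ideal_principal[OF kR], folded P_def]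
  have PR: "p \<in> carrier R" if "p \<in> P" for p using that P'(1) by blast
  define U where "U = {m \<in> P. \<one> \<oplus> m \<in> Units R}"
  have W: "w \<otimes> p = \<ominus> p" if w: "w \<in> P - U" and p: "p \<in> P" for w p
  proof -
    have wR: "w \<in> carrier R" using w PR by simp
    then have "\<one> \<oplus> w \<notin> Units R" using w by (simp add: U_def)
    then obtain r where r: "r \<in> carrier R" "(\<one> \<oplus> w) \<otimes> r = \<zero>" "r \<noteq> \<zero>"
      using Units_if_no_right_annihilator[of "\<one> \<oplus> w"] wR by auto
    have eq: "r \<oplus> w \<otimes> r = \<zero>" using r wR by (simp add: l_distr)
    then have "r = \<ominus> (w \<otimes> r)" using r wR by (metis m_closed minus_equality)
    moreover have "\<ominus> (w \<otimes> r) \<in> P" using w r by (intro P'(6) P'(7)) auto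
    ultimately have "r \<in> P" by simp
    then have "p \<in> principal r" using atom_in_principal_of_mem[OF k] r p by (auto simp: P_def)
    then obtain v where v: "v \<in> carrier R" "p = r \<otimes> v" by (auto simp: principal_def)
    have "p \<oplus> w \<otimes> p = (r \<oplus> w \<otimes> r) \<otimes> v" using v r(1) wR by (simp add: l_distr m_assoc)
    also have "\<dots> = \<zero>" using eq v by simp
    finally have "w \<otimes> p \<oplus> p = \<zero>" using wR PR[OF p] by (simp add: a_comm)
    then show ?thesis using wR PR[OF p] by (metis m_closed minus_equality)
  qed
  have "card (P - U) \<le> card U"
  proof (cases "P - U = {}")
    case False
    then obtain w0 where w0: "w0 \<in> P - U" by blast
    show ?thesis
    proof (rule card_inj_on_le)
      show "finite U" using P'(3) by (simp add: U_def)
      show "inj_on (\<lambda>w. w \<ominus> w0) (P - U)" using PR w0 by (auto intro!: inj_onI simp: minus_eq)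
      show "(\<lambda>w. w \<ominus> w0) ` (P - U) \<subseteq> U"
      proof safe
        fix w assume w: "w \<in> P" "w \<notin> U"
        show "w \<ominus> w0 \<in> U"
        proof (rule ccontr)
          assume "w \<ominus> w0 \<notin> U"
          moreover have "w \<ominus> w0 \<in> P" using w w0 by (intro P'(5)) auto
          ultimately have d: "w \<ominus> w0 \<in> P - U" by simp
          have kP: "k \<in> P" unfolding P_def using kR by (rule in_principal_self)
          have "(w \<ominus> w0) \<otimes> k = w \<otimes> k \<ominus> w0 \<otimes> k"
            using PR w w0 kR by (simp add: minus_eq l_distr l_minus)
          also have "\<dots> = \<zero>" using W[of w k] W[OF w0 kP] w kP kR by (simp add: minus_eq l_neg)
          finally have "\<ominus> k = \<zero>" using W[OF d kP] by simp
          then have "k = \<zero>" using kR by (metis minus_minus minus_zero)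
          then show False using k by (simp add: atom_def)
        qed
      qed
    qed
  next
    case True
    show ?thesis unfolding True by simp
  qed
  moreover have "card P = card U + card (P - U)"
  proof -
    have "U \<subseteq> P" by (auto simp: U_def)
    moreover have "finite U" using calculation P'(3) by (rule finite_subset)
    ultimately show ?thesis using card_mono[OF P'(3), of U] by (simp add: card_Diff_subset)
  qed
  moreover have "card U \<le> K"
    unfolding U_def using right_ideal_principal[OF kR] one
    by (intro card_units_one_plus_right_ideal) (simp_all add: P_def)
  ultimately show ?thesis by (simp add: P_def)
qed

text \<open>
  The ring acts from the left on the set \<open>E\<close> of atoms (with \<open>0\<close> added). Both \<open>E\<close> and the
  kernel \<open>X\<close> of the action are bounded in terms of \<open>K\<close>.
\<close>

theorem card_carrier_le_if_not_division_ring: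
  assumes not_div: "Units R \<noteq> carrier R - {\<zero>}"
  shows "card (carrier R) \<le> (2 * K\<^sup>2 + 1) ^ nat \<lfloor>2 * K\<^sup>2\<rfloor> * K"
proof -
  define E where "E = {k. atom k}"
  have ER: "E \<subseteq> carrier R" by (auto simp: E_def atom_def)
  have finE: "finite E" using ER finite_carrier by (rule finite_subset)
  \<comment> \<open>By the preceding bound for minimal right ideals, each atom has many right annihilators; there
    are few zero products, hence few atoms.\<close>
  have cardE: "card E \<le> 2 * K\<^sup>2"
  proof -
    define ann where "ann k = {z \<in> carrier R. k \<otimes> z = \<zero>}" for k
    have fin_ann: "finite (ann k)" for k using finite_carrier by (simp add: ann_def)
    have "card (carrier R) \<le> 2 * K * card (ann k)" if "k \<in> E" for k
    proof -
      have k: "atom k" and kR: "k \<in> carrier R" using that ER by (auto simp: E_def)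
      have "card (carrier R) \<le> card (principal k) * card (ann k)"
        unfolding principal_def
      proof (rule card_carrier_le_image_times)
        show "ann k \<subseteq> carrier R" by (auto simp: ann_def)
        show "r \<ominus> s \<in> ann k" if "r \<in> carrier R" "s \<in> carrier R" "k \<otimes> r = k \<otimes> s" for r s
          using that kR by (simp add: ann_def minus_eq r_distr r_minus r_neg)
      qed
      then have "real (card (carrier R)) \<le> real (card (principal k)) * card (ann k)"
        by (metis of_nat_le_iff of_nat_mult)
      also have "card (principal k) \<le> 2 * K"
        using card_minimal_right_ideal[OF k] Units_eq_if_atom_generates[OF k] not_div by blast
      finally show ?thesis by (simp add: mult_right_mono)
    qed
    then have "(\<Sum>k\<in>E. real (card (carrier R))) \<le> (\<Sum>k\<in>E. 2 * K * card (ann k))"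
      by (rule sum_mono)
    then have "real (card E) * card (carrier R) \<le> 2 * K * card (SIGMA k:E. ann k)"
      using finE fin_ann by (simp add: sum_distrib_left)
    also have "\<dots> \<le> 2 * K * (K * card (carrier R))"
    proof (rule mult_left_mono)
      have "card (SIGMA k:E. ann k) \<le>
          card {(k, z). k \<in> carrier R \<and> z \<in> carrier R \<and> k \<noteq> \<zero> \<and> k \<otimes> z = \<zero>}"
      proof (rule card_mono)
        show "finite {(k, z). k \<in> carrier R \<and> z \<in> carrier R \<and> k \<noteq> \<zero> \<and> k \<otimes> z = \<zero>}"
          by (rule finite_subset[of _ "carrier R \<times> carrier R"]) (use finite_carrier in auto)
        show "(SIGMA k:E. ann k) \<subseteq> {(k, z). k \<in> carrier R \<and> z \<in> carrier R \<and> k \<noteq> \<zero> \<and> k \<otimes> z = \<zero>}"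
          by (auto simp: ann_def E_def atom_def)
      qed
      then show "card (SIGMA k:E. ann k) \<le> K * card (carrier R)"
        using card_zero_products by linarith
    qed simp
    finally have "card (carrier R) * real (card E) \<le> card (carrier R) * (2 * K\<^sup>2)"
      by (simp add: power2_eq_square mult_ac)
    then show ?thesis
      using finite_carrier by (subst (asm) mult_le_cancel_left_pos) (auto simp: card_gt_0_iff)
  qed
  define X where "X = {r \<in> carrier R. \<forall>k\<in>E. r \<otimes> k = \<zero>}"
  have XR: "X \<subseteq> carrier R" by (auto simp: X_def)
  have "right_ideal X"
    unfolding right_ideal_def
  proof (intro conjI ballI additive_subgroupI_minus)
    show "X \<subseteq> carrier R" by (rule XR)
    show "\<zero> \<in> X" using ER by (auto simp: X_def)
    show "x \<ominus> y \<in> X" if "x \<in> X" "y \<in> X" for x y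
      using that ER by (auto simp: X_def minus_eq l_distr l_minus subset_iff)
    show "x \<otimes> r \<in> X" if x: "x \<in> X" and r: "r \<in> carrier R" for x r
    proof -
      have "x \<otimes> r \<otimes> k = \<zero>" if k: "k \<in> E" for k
      proof (cases "r \<otimes> k = \<zero>")
        case False
        then have "r \<otimes> k \<in> E" using atom_mult_left r k by (auto simp: E_def)
        then show ?thesis using x r k ER by (auto simp: X_def m_assoc subset_iff)
      qed (use x r k ER in \<open>auto simp: X_def m_assoc subset_iff\<close>)
      then show ?thesis using x r by (simp add: X_def)
    qed
  qed
  moreover have "\<one> \<notin> X"
  proof
    obtain s where "s \<in> carrier R" "atom (\<one> \<otimes> s)" using ex_atom[OF one_closed one_not_zero] .
    moreover assume "\<one> \<in> X"
    ultimately show False by (auto simp: X_def E_def atom_def)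
  qed
  ultimately have "card {x \<in> X. \<one> \<oplus> x \<in> Units R} \<le> K"
    by (rule card_units_one_plus_right_ideal)
  moreover have "{x \<in> X. \<one> \<oplus> x \<in> Units R} = X"
  proof -
    \<comment> \<open>A right annihilator \<open>r \<noteq> 0\<close> of \<open>1 + x\<close> has a multiple \<open>r s \<in> E\<close>, which \<open>1 + x\<close> fixes.\<close>
    have "\<one> \<oplus> x \<in> Units R" if x: "x \<in> X" for x
    proof (rule Units_if_no_right_annihilator)
      have xR: "x \<in> carrier R" using x XR by blast
      then show "\<one> \<oplus> x \<in> carrier R" by simp
      fix r assume r: "r \<in> carrier R" "(\<one> \<oplus> x) \<otimes> r = \<zero>"
      show "r = \<zero>"
      proof (rule ccontr)
        assume "r \<noteq> \<zero>"
        then obtain s where s: "s \<in> carrier R" "atom (r \<otimes> s)" using ex_atom r by blast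
        have "x \<otimes> (r \<otimes> s) = \<zero>" using x s by (simp add: X_def E_def)
        then have "(\<one> \<oplus> x) \<otimes> (r \<otimes> s) = r \<otimes> s" using xR r s by (simp add: l_distr)
        moreover have "(\<one> \<oplus> x) \<otimes> (r \<otimes> s) = (\<one> \<oplus> x) \<otimes> r \<otimes> s"
          using xR r(1) s by (simp add: m_assoc)
        ultimately show False using r s by (simp add: atom_def)
      qed
    qed
    then show ?thesis by blast
  qed
  ultimately have cardX: "card X \<le> K" by simp
  \<comment> \<open>The action on \<open>E\<close> has kernel \<open>X\<close> and takes at most \<open>(|E| + 1) ^ |E|\<close> values.\<close>
  define f where "f r = (\<lambda>k\<in>E. r \<otimes> k)" for r
  have "card (carrier R) \<le> card (f ` carrier R) * card X"
  proof (rule card_carrier_le_image_times[OF XR])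
    fix r s assume rs: "r \<in> carrier R" "s \<in> carrier R" "f r = f s"
    have "r \<otimes> k = s \<otimes> k" if "k \<in> E" for k
      using fun_cong[OF rs(3), of k] that by (simp add: f_def)
    then show "r \<ominus> s \<in> X"
      using rs ER by (auto simp: X_def minus_eq l_distr l_minus r_neg subset_iff)
  qed
  moreover have "card (f ` carrier R) \<le> (card E + 1) ^ card E"
  proof -
    have "f ` carrier R \<subseteq> E \<rightarrow>\<^sub>E insert \<zero> E"
    proof -
      have "r \<otimes> k \<in> insert \<zero> E" if "r \<in> carrier R" "k \<in> E" for r k
        using atom_mult_left that by (auto simp: E_def)
      then show ?thesis unfolding f_def by (intro image_subsetI) (simp only: restrict_PiE_iff, blast)
    qed
    then have "card (f ` carrier R) \<le> card (E \<rightarrow>\<^sub>E insert \<zero> E)"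
      using finE by (intro card_mono finite_PiE) auto
    also have "\<dots> = (card E + 1) ^ card E"
      using finE by (simp add: card_PiE E_def atom_def)
    finally show ?thesis .
  qed
  ultimately have "card (carrier R) \<le> (card E + 1) ^ card E * card X"
    by (meson le_trans mult_le_mono1)
  then have "real (card (carrier R)) \<le> real ((card E + 1) ^ card E) * real (card X)"
    by (metis of_nat_le_iff of_nat_mult)
  also have "\<dots> \<le> (2 * K\<^sup>2 + 1) ^ nat \<lfloor>2 * K\<^sup>2\<rfloor> * K"
  proof (rule mult_mono)
    have "real ((card E + 1) ^ card E) \<le> (2 * K\<^sup>2 + 1) ^ card E"
      using cardE by (auto intro: power_mono)
    also have "\<dots> \<le> (2 * K\<^sup>2 + 1) ^ nat \<lfloor>2 * K\<^sup>2\<rfloor>"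
      using cardE by (intro power_increasing) (auto simp: le_nat_iff le_floor_iff)
    finally show "real ((card E + 1) ^ card E) \<le> (2 * K\<^sup>2 + 1) ^ nat \<lfloor>2 * K\<^sup>2\<rfloor>" .
  qed (use cardX in auto)
  finally show ?thesis .
qed

end


section \<open>Sequences of rings with a uniform Salem bound\<close>

theorem theorem1p3:
  fixes d :: nat
    and R :: "nat \<Rightarrow> ('a, 'b) ring_scheme"
    and t :: "nat \<Rightarrow> 'a"
    and C :: real
  assumes "d \<ge> 2"
    and "\<And>i. ring (R i)"
    and "\<And>i. finite (carrier (R i))"
    and "\<And>i. \<one>\<^bsub>R i\<^esub> \<noteq> \<zero>\<^bsub>R i\<^esub>"
    and "\<And>i. t i \<in> Units (R i)"
    and "filterlim (\<lambda>i. card (carrier (R i))) at_top sequentially"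
    and "\<And>i. salem_bound (R i) d (t i) C"
  shows "\<exists>i0. \<forall>i\<ge>i0. field (R i)"
proof -
  define b where "b = (2 * (2 * C\<^sup>2)\<^sup>2 + 1) ^ nat \<lfloor>2 * (2 * C\<^sup>2)\<^sup>2\<rfloor> * (2 * C\<^sup>2)"
  have "eventually (\<lambda>i. nat \<lceil>b\<rceil> + 1 \<le> card (carrier (R i))) sequentially"
    using assms(6) by (auto simp: filterlim_at_top)
  then obtain i0 where i0: "\<And>i. i \<ge> i0 \<Longrightarrow> nat \<lceil>b\<rceil> + 1 \<le> card (carrier (R i))"
    by (auto simp: eventually_sequentially)
  have "field (R i)" if "i \<ge> i0" for i
  proof -
    interpret finite_ring "R i"
      using assms(2-4) by (intro finite_ring.intro finite_ring_axioms.intro)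
    interpret salem_ring "R i" d "t i" C
      using assms(1,5,7) by unfold_locales
    have "real (card (carrier (R i))) > b" using i0[OF that] by linarith
    then have "Units (R i) = carrier (R i) - {\<zero>\<^bsub>R i\<^esub>}"
      using card_carrier_le_if_not_division_ring unfolding b_def by linarith
    then interpret finite_division_ring "R i" by unfold_locales
    show ?thesis by (rule is_field)
  qed
  then show ?thesis by blast
qed

end
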